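(* The factor complexity of Kimberling's infinite word ${\bf B}$ is $2n$ for $n\ge 1$; that is, for every $n\ge 1$ exactly $2n$ distinct words of length $n$ occur as factors of ${\bf B}$.
   Context: Definition of ${\bf B}$: Let $B_0=00$. Given a binary word $B_i$, factor it into blocks: each letter $1$ is a block by itself, and each maximal run of consecutive $0$'s is a block, which is either $0$ or $00$ (runs of three or more $0$'s never occur). Then $B_{i+1}$ is obtained by replacing each block $0$ by $0$, each block $1$ by $10$, and each block $00$ by $0101$. For example $B_1=0101$, $B_2=010010$, $B_3=0100101100$. For $i\ge 2$, $B_i$ is a prefix of $B_{i+1}$, and ${\bf B}=0100101100\cdots$ is the unique infinite word having all $B_i$, $i\ge 2$, as prefixes. A factor of an infinite word is a finite contiguous block of letters in it; the factor complexity is the function mapping $n$ to the number of distinct factors of length $n$. *)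

theory Defs
  imports "HOL-Library.Omega_Words_Fun"
begin

datatype letter = Zero | One

text \<open>Factorization into blocks: each \<^const>\<open>One\<close> is a block, and each maximal run of
  \<^const>\<open>Zero\<close>s (of whatever length) is a block.\<close>

function blocks :: "letter list \<Rightarrow> letter list list" where
  "blocks [] = []"
| "blocks (One # w) = [One] # blocks w"
| "blocks (Zero # w) =
     (Zero # takeWhile (\<lambda>a. a = Zero) w) # blocks (dropWhile (\<lambda>a. a = Zero) w)"
  by pat_completeness auto
termination
  by (relation "measure length") (auto simp: less_Suc_eq_le length_dropWhile_le)

text \<open>The value on runs of three or more \<^const>\<open>Zero\<close>s is irrelevant: by \<open>blocks_kimberling\<close>
  below, such runs do not arise.\<close>

definition replace_block :: "letter list \<Rightarrow> letter list" where
  "replace_block b =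
     (if b = [Zero] then [Zero]
      else if b = [One] then [One, Zero]
      else if b = [Zero, Zero] then [Zero, One, Zero, One]
      else undefined)"

definition kimberling_step :: "letter list \<Rightarrow> letter list" where
  "kimberling_step w = concat (map replace_block (blocks w))"

primrec kimberling :: "nat \<Rightarrow> letter list" where
  "kimberling 0 = [Zero, Zero]"
| "kimberling (Suc i) = kimberling_step (kimberling i)"

text \<open>Infinite words are functions on \<^typ>\<open>nat\<close>; that exactly one word is described here is
  \<open>ex1_kimberling_word\<close> below.\<close>

definition kimberling_word :: "letter word" where
  "kimberling_word =
     (THE w. \<forall>i\<ge>2. prefix (length (kimberling i)) w = kimberling i)"

definition factors :: "'a word \<Rightarrow> 'a list set" where
  "factors w = {w [i \<rightarrow> j] | i j. i \<le> j}"

definition factor_complexity :: "'a word \<Rightarrow> nat \<Rightarrow> nat" where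
  "factor_complexity w n = card {u \<in> factors w. length u = n}"

lemma kimberling_step_simps [simp]:
  "kimberling_step [] = []"
  "kimberling_step (One # w) = One # Zero # kimberling_step w"
  "kimberling_step [Zero] = [Zero]"
  "kimberling_step (Zero # One # w) = Zero # One # Zero # kimberling_step w"
  "kimberling_step [Zero, Zero] = [Zero, One, Zero, One]"
  "kimberling_step (Zero # Zero # One # w) =
     Zero # One # Zero # One # One # Zero # kimberling_step w"
  by (simp_all add: kimberling_step_def replace_block_def)

lemma kimberling_1: "kimberling 1 = [Zero, One, Zero, One]"
  by simp

lemma kimberling_2: "kimberling 2 = [Zero, One, Zero, Zero, One, Zero]"
  by (simp add: numeral_2_eq_2)

lemma kimberling_3:
  "kimberling 3 = [Zero, One, Zero, Zero, One, Zero, One, One, Zero, Zero]"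
  by (simp add: numeral_3_eq_3)

lemma blocks_kimberling_step:
  assumes "set (blocks w) \<subseteq> {[Zero], [One], [Zero, Zero]}"
  shows "set (blocks (kimberling_step w)) \<subseteq> {[Zero], [One], [Zero, Zero]} \<and>
         set (blocks (Zero # kimberling_step w)) \<subseteq> {[Zero], [One], [Zero, Zero]}"
  using assms
proof (induction "length w" arbitrary: w rule: less_induct)
  case less
  show ?case
  proof (cases w)
    case Nil
    then show ?thesis by simp
  next
    case (Cons a v)
    show ?thesis
    proof (cases a)
      case One
      then show ?thesis using less.hyps[of v] less.prems Cons by auto
    next
      case Zero
      define r where "r = dropWhile (\<lambda>a. a = Zero) v"
      have w: "w = (Zero # takeWhile (\<lambda>a. a = Zero) v) @ r"
        by (simp add: Cons Zero r_def)
      have rb: "set (blocks r) \<subseteq> {[Zero], [One], [Zero, Zero]}"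
        and t: "takeWhile (\<lambda>a. a = Zero) v \<in> {[], [Zero]}"
        using less.prems by (auto simp: Cons Zero r_def)
      consider "r = []" | s where "r = One # s"
        by (metis (full_types) hd_dropWhile letter.exhaust list.exhaust_sel r_def)
      then show ?thesis
      proof cases
        case 1
        then show ?thesis using t by (auto simp: w)
      next
        case 2
        then have "length s < length w" "set (blocks s) \<subseteq> {[Zero], [One], [Zero, Zero]}"
          using rb by (auto simp: w)
        then show ?thesis using less.hyps[of s] t 2 by (auto simp: w)
      qed
    qed
  qed
qed

lemma blocks_kimberling: "set (blocks (kimberling i)) \<subseteq> {[Zero], [One], [Zero, Zero]}"
  by (induction i) (use blocks_kimberling_step in auto)

lemma blocks_append_One: "blocks (u @ One # v) = blocks u @ blocks (One # v)"
proof (induction u rule: blocks.induct)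
  case (3 w)
  have "takeWhile (\<lambda>a. a = Zero) (w @ One # v) = takeWhile (\<lambda>a. a = Zero) w"
    "dropWhile (\<lambda>a. a = Zero) (w @ One # v) = dropWhile (\<lambda>a. a = Zero) w @ One # v"
    by (induction w) auto
  with 3 show ?case by simp
qed simp_all

lemma kimberling_Suc:
  assumes "i \<ge> 2"
  shows "\<exists>v. kimberling (Suc i) = kimberling i @ One # v"
  using assms
proof (induction i rule: dec_induct)
  case base
  show ?case using kimberling_2 kimberling_3 by (simp add: numeral_3_eq_3 numeral_2_eq_2)
next
  case (step i)
  then obtain v where "kimberling (Suc i) = kimberling i @ One # v" by blast
  then have "kimberling (Suc (Suc i)) = kimberling (Suc i) @ kimberling_step (One # v)"
    by (simp only: kimberling.simps(2) [of "Suc i"])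
       (simp add: kimberling_step_def blocks_append_One)
  then show ?case by simp
qed

lemma kimberling_length: "i < length (kimberling (i + 2))"
proof (induction i)
  case 0
  show ?case using kimberling_2 by simp
next
  case (Suc i)
  obtain v where "kimberling (Suc (i + 2)) = kimberling (i + 2) @ One # v"
    using kimberling_Suc[of "i + 2"] by auto
  then have "length (kimberling (Suc i + 2)) > length (kimberling (i + 2))"
    by (metis add_Suc length_append length_Cons less_add_Suc1 add_Suc_right)
  with Suc show ?case by linarith
qed

lemma kimberling_nth:
  assumes "2 \<le> i" "i \<le> j" "n < length (kimberling i)"
  shows "n < length (kimberling j) \<and> kimberling j ! n = kimberling i ! n"
  using assms(2)
proof (induction j rule: dec_induct)
  case base
  show ?case using assms by simp
next
  case (step j)
  obtain v where "kimberling (Suc j) = kimberling j @ One # v"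
    using kimberling_Suc[of j] step assms by auto
  with step show ?case by (simp only:) (simp add: nth_append)
qed

lemma ex1_kimberling_word:
  "\<exists>!w. \<forall>i\<ge>2. prefix (length (kimberling i)) w = kimberling i"
proof (rule ex_ex1I)
  define w where "w n = kimberling (n + 2) ! n" for n
  have "prefix (length (kimberling i)) w = kimberling i" if "i \<ge> 2" for i
  proof (rule nth_equalityI)
    fix n assume "n < length (prefix (length (kimberling i)) w)"
    then have n: "n < length (kimberling i)" by simp
    have "kimberling (n + 2) ! n = kimberling i ! n"
      using kimberling_nth[of "n + 2" i n] kimberling_nth[of i "n + 2" n]
        kimberling_length[of n] n that by (cases "i \<le> n + 2") auto
    then show "prefix (length (kimberling i)) w ! n = kimberling i ! n"
      using n by (simp add: subsequence_def w_def)
  qed simp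
  then show "\<exists>w. \<forall>i\<ge>2. prefix (length (kimberling i)) w = kimberling i" by blast
next
  fix w w' :: "letter word"
  assume w: "\<forall>i\<ge>2. prefix (length (kimberling i)) w = kimberling i"
    and w': "\<forall>i\<ge>2. prefix (length (kimberling i)) w' = kimberling i"
  show "w = w'"
  proof
    fix n
    have "prefix (length (kimberling (n + 2))) w ! n = prefix (length (kimberling (n + 2))) w' ! n"
      using w w' by (simp del: kimberling.simps add_2_eq_Suc')
    then show "w n = w' n"
      using kimberling_length[of n] by (simp add: subsequence_def del: kimberling.simps)
  qed
qed

end

theory Submission
  imports Defs "HOL-Library.Sublist"
begin

text \<open>Cutting \<open>B\<close> after each \<^const>\<open>One\<close> turns the block substitution into
  \<open>1 \<mapsto> 01 \<mapsto> 001 \<mapsto> 001 01 1\<close>, up to conjugation by \<^const>\<open>Zero\<close>. So \<open>B\<close> is \<open>01\<close> followed by the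
  limit of the Tribonacci-like words \<open>A\<^sub>0 = 1\<close>, \<open>A\<^sub>1 = 01\<close>, \<open>A\<^sub>2 = 001\<close>,
  \<open>A\<^sub>n\<^sub>+\<^sub>3 = A\<^sub>n\<^sub>+\<^sub>2 A\<^sub>n\<^sub>+\<^sub>1 A\<^sub>n\<close>.

  Every prefix of \<open>B\<close>, and every prefix of \<open>B\<close> without its first letter, can be extended to the
  left by both letters; hence the complexity grows by at least 2 at each step. It therefore suffices
  to find arbitrarily large \<open>N\<close> with at most \<open>2N\<close> factors of length \<open>N\<close>. Put \<open>k = 3j\<close> and let \<open>C\<close>
  be the longest common prefix of everything that can follow a block \<open>A\<^sub>k\<^sub>+\<^sub>2\<close>. For
  \<open>N = |C| + 1\<close> every factor of length \<open>N\<close> occurs in \<open>A\<^sub>k\<^sub>+\<^sub>1 A\<^sub>k C\<close>,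
  \<open>A\<^sub>k\<^sub>+\<^sub>1 C\<close> or \<open>A\<^sub>k\<^sub>+\<^sub>2 C\<close>, and these words contain at most \<open>2N\<close> of them.\<close>

section \<open>The Tribonacci-like words and the factors of B\<close>

fun trib :: "nat \<Rightarrow> letter list" where
  "trib 0 = [One]"
| "trib (Suc 0) = [Zero, One]"
| "trib (Suc (Suc 0)) = [Zero, Zero, One]"
| "trib (Suc (Suc (Suc n))) = trib (Suc (Suc n)) @ trib (Suc n) @ trib n"

lemma length_trib: "n < length (trib n)"
  by (induction n rule: trib.induct) auto

lemma prefix_trib:
  assumes "2 \<le> m" "m \<le> n"
  shows "Sublist.prefix (trib m) (trib n)"
  using assms(2)
proof (induction n rule: dec_induct)
  case (step n)
  then obtain k where "n = Suc (Suc k)"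
    using assms(1) by (metis add_2_eq_Suc le_Suc_ex le_trans)
  then have "Sublist.prefix (trib n) (trib (Suc n))" by simp
  with step show ?case using prefix_order.trans by blast
qed simp

text \<open>The image of each \<open>One\<close> ends in \<open>Zero\<close>; that letter is moved
  across the block boundary and leads the image of the next block.\<close>

lemma kimberling_step_trib:
  "Zero # kimberling_step (trib n @ v) = trib (Suc n) @ Zero # kimberling_step v"
proof (induction n arbitrary: v rule: trib.induct)
  case (4 n)
  have "Zero # kimberling_step (trib (Suc (Suc (Suc n))) @ v) =
        trib (Suc (Suc (Suc n))) @ trib (Suc (Suc n)) @ trib (Suc n) @ Zero # kimberling_step v"
    by (simp only: trib.simps(4) [of n] append_assoc 4)
  then show ?case by simp
qed simp_all

lemma kimberling_eq_trib:
  assumes "2 \<le> n"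
  shows "\<exists>v. kimberling n = [Zero, One] @ trib n @ v"
  using assms
proof (induction n rule: dec_induct)
  case base
  show ?case by (simp add: numeral_2_eq_2)
next
  case (step n)
  then obtain v where "kimberling n = [Zero, One] @ trib n @ v" by blast
  \<comment> \<open>The head \<open>01\<close> reproduces itself and leaves behind the leading
    \<open>Zero\<close> that \<open>kimberling_step_trib\<close> wants.\<close>
  then have "kimberling (Suc n) = [Zero, One] @ trib (Suc n) @ Zero # kimberling_step v"
    using kimberling_step_trib[of n v] by simp
  then show ?case by blast
qed

lemma prefix_kimberling_word:
  assumes "2 \<le> n"
  shows "kimberling_word [0 \<rightarrow> length (trib n) + 2] = [Zero, One] @ trib n"
proof -
  obtain v where v: "kimberling n = [Zero, One] @ trib n @ v"
    using kimberling_eq_trib[OF assms] by blast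
  have "kimberling_word [0 \<rightarrow> length (kimberling n)] = kimberling n"
    using theI'[OF ex1_kimberling_word] assms unfolding kimberling_word_def by blast
  then have "take (length (trib n) + 2) (kimberling_word [0 \<rightarrow> length (kimberling n)]) =
      [Zero, One] @ trib n"
    using v by simp
  moreover have "length (trib n) + 2 \<le> length (kimberling n)"
    by (simp add: v)
  ultimately show ?thesis by (simp only: subsequence_take add_0 min.absorb1)
qed

lemma factors_kimberling_word:
  "u \<in> factors kimberling_word \<longleftrightarrow> (\<exists>n\<ge>2. sublist u ([Zero, One] @ trib n))"
proof
  assume "u \<in> factors kimberling_word"
  then obtain i j where u: "u = kimberling_word [i \<rightarrow> j]" "i \<le> j"
    by (auto simp: factors_def)
  define n where "n = j + 2"
  have "j \<le> length (trib n) + 2" "2 \<le> n"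
    using length_trib[of n] by (simp_all add: n_def)
  then have "u = drop i (take j ([Zero, One] @ trib n))"
    using u prefix_kimberling_word[of n] by (metis subsequence_drop subsequence_take min.absorb1 add_0)
  then have "sublist u ([Zero, One] @ trib n)"
    by (metis sublist_drop sublist_order.order.trans sublist_take)
  then show "\<exists>n\<ge>2. sublist u ([Zero, One] @ trib n)" using \<open>2 \<le> n\<close> by blast
next
  assume "\<exists>n\<ge>2. sublist u ([Zero, One] @ trib n)"
  then obtain n ps ss where n: "2 \<le> n" "[Zero, One] @ trib n = ps @ u @ ss"
    by (auto simp: sublist_def)
  have "length (trib n) + 2 = length ps + length u + length ss"
    using arg_cong[OF n(2), of length] by simp
  then have "u = take (length u) (drop (length ps) (kimberling_word [0 \<rightarrow> length (trib n) + 2]))"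
    using prefix_kimberling_word[OF n(1)] n(2) by simp
  then have "u = kimberling_word [length ps \<rightarrow> min (length ps + length u) (length (trib n) + 2)]"
    by (simp only: subsequence_drop subsequence_take add_0)
  moreover have "length ps \<le> min (length ps + length u) (length (trib n) + 2)"
    using \<open>length (trib n) + 2 = _\<close> by simp
  ultimately show "u \<in> factors kimberling_word"
    unfolding factors_def by blast
qed

lemma factor_sublist:
  assumes "u \<in> factors kimberling_word" "sublist v u"
  shows "v \<in> factors kimberling_word"
  using assms by (meson factors_kimberling_word sublist_order.order.trans)

lemma factor_trib:
  assumes "sublist u (trib n)"
  shows "u \<in> factors kimberling_word"
proof (cases "2 \<le> n")
  case True
  then show ?thesis using assms factors_kimberling_word sublist_appendI
    by (metis sublist_append_leftI sublist_order.order.trans)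
next
  case False
  then have "n = 0 \<or> n = 1" by auto
  then have "sublist (trib n) ([Zero, One] @ trib 2)"
    by (auto simp: sublist_Cons_right numeral_2_eq_2)
  then show ?thesis using assms factors_kimberling_word by (meson order_refl sublist_order.order.trans)
qed

lemma factor_trib_append:
  assumes "2 \<le> n" "n \<le> m + 2"
  shows "trib m @ trib n \<in> factors kimberling_word"
proof -
  obtain v where "trib (m + 2) = trib n @ v"
    using prefix_trib[OF assms] by (auto simp: Sublist.prefix_def)
  then have "trib (m + 4) = (trib (m + 2) @ trib (m + 1)) @ (trib m @ trib n) @ v @ trib (m + 1)"
    by (simp add: numeral_eq_Suc)
  then have "sublist (trib m @ trib n) (trib (m + 4))" by (metis sublist_appendI)
  then show ?thesis by (rule factor_trib)
qed

lemma suffix_trib_mod_3: "Sublist.suffix (trib m) (trib (3 * j + m))"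
proof (induction j)
  case (Suc j)
  have "3 * Suc j + m = Suc (Suc (Suc (3 * j + m)))" by simp
  then have "Sublist.suffix (trib (3 * j + m)) (trib (3 * Suc j + m))"
    by (simp only: trib.simps) (metis append.assoc suffixI)
  with Suc show ?case using suffix_order.trans by blast
qed simp

lemma factor_append_trib:
  assumes "2 \<le> n" "Sublist.suffix p (trib m)"
  shows "p @ trib n \<in> factors kimberling_word"
proof -
  \<comment> \<open>Adding a multiple of 3 to the index keeps the ending and makes the index large
    enough for \<open>factor_trib_append\<close>.\<close>
  have "Sublist.suffix p (trib (3 * n + m))"
    using assms(2) suffix_trib_mod_3 suffix_order.trans by blast
  then obtain q where "trib (3 * n + m) = q @ p" by (auto simp: Sublist.suffix_def)
  then have "(q @ p) @ trib n \<in> factors kimberling_word"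
    using factor_trib_append[of n "3 * n + m"] assms(1) by simp
  then show ?thesis by (rule factor_sublist) simp
qed

section \<open>Left special factors and the lower bound\<close>

lemma left_special_trib:
  assumes "2 \<le> n"
  shows "a # Zero # One # trib n \<in> factors kimberling_word"
    and "a # One # trib n \<in> factors kimberling_word"
proof -
  have s: "Sublist.suffix [Zero, Zero, One] (trib 2)" "Sublist.suffix [One, Zero, One] (trib 4)"
    "Sublist.suffix [Zero, One] (trib 1)" "Sublist.suffix [One, One] (trib 3)"
    by (simp_all add: numeral_eq_Suc Sublist.suffix_def)
  show "a # Zero # One # trib n \<in> factors kimberling_word"
    using factor_append_trib[OF assms s(1)] factor_append_trib[OF assms s(2)]
    by (cases a) simp_all
  show "a # One # trib n \<in> factors kimberling_word"
    using factor_append_trib[OF assms s(3)] factor_append_trib[OF assms s(4)]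
    by (cases a) simp_all
qed

text \<open>Only an occurrence at the start of B lacks a preceding letter; there \<open>Zero\<close>
  can be put in front by \<open>left_special_trib\<close>.\<close>

lemma left_extension:
  assumes "u \<in> factors kimberling_word"
  shows "\<exists>a. a # u \<in> factors kimberling_word"
proof -
  obtain n ps ss where n: "2 \<le> n" "[Zero, One] @ trib n = ps @ u @ ss"
    using assms by (auto simp: factors_kimberling_word sublist_def)
  then have "Zero # ps @ u @ ss \<in> factors kimberling_word"
    using left_special_trib(1)[OF n(1), of Zero] by simp
  moreover have "sublist (last (Zero # ps) # u) (Zero # ps @ u @ ss)"
  proof (cases ps rule: rev_cases)
    case (snoc ps' a)
    then have "Zero # ps @ u @ ss = (Zero # ps') @ (last (Zero # ps) # u) @ ss" by simp
    then show ?thesis by (metis sublist_appendI)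
  qed (metis append_Nil append_Cons last.simps sublist_append_rightI)
  ultimately show ?thesis using factor_sublist by blast
qed

definition factors_of_length :: "nat \<Rightarrow> letter list set" where
  "factors_of_length n = {u \<in> factors kimberling_word. length u = n}"

lemma finite_factors_of_length: "finite (factors_of_length n)"
proof -
  have "UNIV = {Zero, One}" using letter.exhaust by auto
  then have "finite (UNIV :: letter set)" by (metis finite.simps)
  then show ?thesis
    using finite_lists_length_eq[of UNIV n]
    by (auto simp: factors_of_length_def intro: rev_finite_subset)
qed

text \<open>Choose one left extension per factor; the left special \<open>s\<close> and
  \<open>t\<close>, distinct by their first letters, each add a second.\<close>

lemma card_factors_Suc:
  assumes "1 \<le> n"
  shows "card (factors_of_length n) + 2 \<le> card (factors_of_length (Suc n))"
proof -
  define m where "m = n + 2"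
  define s t where "s = take n (Zero # One # trib m)" and "t = take n (One # trib m)"
  have len: "length s = n" "length t = n"
    using length_trib[of m] by (simp_all add: s_def t_def m_def)
  have st: "s \<noteq> t" using assms by (cases n) (auto simp: s_def t_def)
  have ext: "a # s \<in> factors kimberling_word" "a # t \<in> factors kimberling_word" for a
    using left_special_trib[of m a] factor_sublist
      sublist_take[of "Suc n" "a # Zero # One # trib m"] sublist_take[of "Suc n" "a # One # trib m"]
    by (auto simp: s_def t_def m_def)
  have mem: "s \<in> factors_of_length n" "t \<in> factors_of_length n"
    using factor_sublist[OF ext(1), of s] factor_sublist[OF ext(2), of t] len
    by (auto simp: factors_of_length_def sublist_Cons_right)
  obtain f where f: "f u # u \<in> factors kimberling_word" if "u \<in> factors_of_length n" for u
    using left_extension unfolding factors_of_length_def by (metis (mono_tags, lifting) mem_Collect_eq)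
  define g where "g a = (if a = Zero then One else Zero)" for a
  have g: "g a \<noteq> a" for a by (cases a) (simp_all add: g_def)
  let ?A = "(\<lambda>u. f u # u) ` factors_of_length n" and ?B = "{g (f s) # s, g (f t) # t}"
  have "card ?A = card (factors_of_length n)" by (rule card_image) (simp add: inj_on_def)
  moreover have "card ?B = 2" using st by simp
  moreover have "?A \<inter> ?B = {}" using g by auto
  ultimately have "card (?A \<union> ?B) = card (factors_of_length n) + 2"
    by (subst card_Un_disjoint) (auto simp: finite_factors_of_length)
  moreover have "?A \<union> ?B \<subseteq> factors_of_length (Suc n)"
    using f ext len by (auto simp: factors_of_length_def)
  then have "card (?A \<union> ?B) \<le> card (factors_of_length (Suc n))"
    by (rule card_mono[OF finite_factors_of_length])
  ultimately show ?thesis by linarith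
qed

lemma card_factors_diff:
  assumes "1 \<le> m" "m \<le> n"
  shows "card (factors_of_length m) + 2 * (n - m) \<le> card (factors_of_length n)"
  using assms(2)
proof (induction n rule: dec_induct)
  case (step n)
  then show ?case using card_factors_Suc[of n] assms(1) by (simp add: Suc_diff_le)
qed simp

lemma card_factors_ge:
  assumes "1 \<le> n"
  shows "2 * n \<le> card (factors_of_length n)"
proof -
  have "{[Zero], [One]} \<subseteq> factors_of_length 1"
    using factor_trib[of "[Zero]" 1] factor_trib[of "[One]" 0]
    by (simp add: factors_of_length_def sublist_Cons_right)
  then have "card {[Zero], [One]} \<le> card (factors_of_length 1)"
    by (rule card_mono[OF finite_factors_of_length])
  then show ?thesis using card_factors_diff[OF _ assms] by force
qed

section \<open>Common prefixes of the continuations\<close>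

text \<open>\<open>branch k\<close> is the word \<open>C\<close> above. At level \<open>k\<close>, \<open>A\<^sub>k\<^sub>+\<^sub>2\<close> is followed by one of
  \<open>A\<^sub>k\<^sub>+\<^sub>1 A\<^sub>k\<close>, \<open>A\<^sub>k\<^sub>+\<^sub>1 A\<^sub>k\<^sub>+\<^sub>2\<close> and \<open>A\<^sub>k\<^sub>+\<^sub>2\<close>; one level up, each of these continuations starts
  with \<open>A\<^sub>k\<^sub>+\<^sub>2\<close> followed by another one of the three.\<close>

primrec branch :: "nat \<Rightarrow> letter list" where
  "branch 0 = [Zero]"
| "branch (Suc k) = trib (Suc (Suc k)) @ branch k"

text \<open>Cancelling the leading \<open>trib (Suc (Suc k))\<close> reduces the three claims one
  level up to the second, third and first claim at \<open>k\<close>, the latter two with help from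
  the second.\<close>

lemma prefix_branch:
  "Sublist.prefix (branch k) (trib (Suc k) @ branch k)"
  "Sublist.prefix (branch k) (trib (Suc (Suc k)) @ branch k)"
  "Sublist.prefix (branch k) (trib (Suc k) @ trib k @ branch k)"
proof (induction k)
  case (Suc k)
  {
    case 1
    show ?case using Suc by simp
  next
    case 2
    have "Sublist.prefix (branch k) (trib (Suc k) @ trib k @ trib (Suc (Suc k)) @ branch k)"
      using Suc(2,3) by (metis append.assoc prefix_order.trans same_prefix_prefix)
    then show ?case by simp
  next
    case 3
    have "Sublist.prefix (branch k) (trib (Suc k) @ trib (Suc (Suc k)) @ branch k)"
      using Suc(1,2) by (metis prefix_order.trans same_prefix_prefix)
    then show ?case by simp
  }
qed simp_all

lemma prefix_branch_trib:
  assumes "k < m"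
  shows "Sublist.prefix (branch k) (trib m @ branch k)"
  using assms
proof (induction m rule: less_induct)
  case (less m)
  consider "m = Suc k" | "m = Suc (Suc k)" | "m = Suc (Suc (Suc k))"
    | i where "m = Suc (Suc (Suc i))" "k < i"
    using less.prems by atomize_elim presburger
  then show ?case
  proof cases
    \<comment> \<open>\<open>trib k @ branch k\<close> need not begin with \<open>branch k\<close>
      (it does not for \<open>k = 0\<close>), so \<open>trib (Suc k) @ trib k\<close> stays one
      unit.\<close>
    case 3
    then show ?thesis using prefix_branch(2,3)[of k]
      by simp (metis prefix_order.trans same_prefix_prefix)
  next
    case 4
    then have "Sublist.prefix (branch k) (trib i @ branch k)"
      "Sublist.prefix (branch k) (trib (Suc i) @ branch k)"
      "Sublist.prefix (branch k) (trib (Suc (Suc i)) @ branch k)"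
      using less.IH by simp_all
    then show ?thesis using 4
      by simp (metis prefix_order.trans same_prefix_prefix)
  qed (use prefix_branch in simp_all)
qed

lemma length_branch: "k < length (branch k)"
proof (induction k)
  case (Suc k)
  then show ?case using length_trib[of "Suc (Suc k)"] by simp
qed simp

text \<open>Makes the window count in \<open>card_factors_le\<close> equal to \<open>2 * N\<close>
  with \<open>N = length (branch k) + 1\<close>: the 6 is 2 plus the four shared windows.\<close>

lemma length_branch_eq:
  "2 * length (branch k) + 6 =
    length (trib k) + 2 * length (trib (Suc k)) + length (trib (Suc (Suc k)))"
  by (induction k) simp_all

section \<open>Windows of length N and the upper bound\<close>

lemma sublist_append_branch:
  assumes "sublist u (x @ z)" "length u = Suc (length c)" "Sublist.prefix c z"
  shows "sublist u (x @ c) \<or> sublist u z"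
proof -
  consider "sublist u x" | "sublist u z"
    | p q where "u = p @ q" "Sublist.suffix p x" "Sublist.prefix q z"
    using assms(1) by (auto simp: sublist_append)
  then show ?thesis
  proof cases
    case 1
    then show ?thesis by (simp add: sublist_append)
  next
    case (3 p q)
    show ?thesis
    proof (cases "p = []")
      case True
      then show ?thesis using 3 by (simp add: prefix_imp_sublist)
    next
      case False
      \<comment> \<open>As \<open>p\<close> is nonempty, at most \<open>length c\<close> letters of
        \<open>u\<close> reach into \<open>z\<close>, all within its prefix
        \<open>c\<close>.\<close>
      then have "length q \<le> length c" using assms(2) 3(1) by (cases p) auto
      then have "Sublist.prefix q c" using 3(3) assms(3) prefix_length_prefix by blast
      then show ?thesis using 3 by (auto simp: sublist_append)
    qed
  qed simp
qed

text \<open>Descent along the recursion, cutting wherever the remainder begins with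
  \<open>branch k\<close>. No such cut is available before \<open>trib k @ branch k\<close>, whence
  the first alternative.\<close>

lemma sublist_trib_branch:
  assumes "sublist u (trib n @ branch k)" "length u = Suc (length (branch k))" "k \<le> n"
  shows "sublist u (trib (Suc k) @ trib k @ branch k) \<or> sublist u (trib (Suc k) @ branch k) \<or>
    sublist u (trib (Suc (Suc k)) @ branch k)"
  using assms(1,3)
proof (induction n rule: less_induct)
  case (less n)
  consider "n = k" | "n = Suc k" | "n = Suc (Suc k)" | i where "n = Suc (Suc (Suc i))" "k \<le> i"
    using less.prems(2) by atomize_elim presburger
  then show ?case
  proof cases
    case 1
    then show ?thesis using less.prems by (auto simp: sublist_append)
  next
    case (4 i)
    have p: "Sublist.prefix (branch k) (trib (Suc i) @ trib i @ branch k)"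
    proof (cases "i = k")
      case False
      then show ?thesis using 4 prefix_branch_trib[of k i] prefix_branch_trib[of k "Suc i"]
        by (metis le_SucI le_neq_implies_less less_Suc_eq prefix_order.trans same_prefix_prefix)
    qed (simp add: prefix_branch)
    have "sublist u (trib (Suc (Suc i)) @ trib (Suc i) @ trib i @ branch k)"
      using less.prems 4 by simp
    from sublist_append_branch[OF this assms(2) p]
    consider "sublist u (trib (Suc (Suc i)) @ branch k)"
      | "sublist u (trib (Suc i) @ trib i @ branch k)" by blast
    then show ?thesis
    proof cases
      case 1
      then show ?thesis using less.IH[of "Suc (Suc i)"] 4 by simp
    next
      case 2
      show ?thesis
      proof (cases "i = k")
        case False
        then have "Sublist.prefix (branch k) (trib i @ branch k)"
          using 4 prefix_branch_trib[of k i] by simp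
        from sublist_append_branch[OF 2 assms(2) this] show ?thesis
          using less.IH[of "Suc i"] less.IH[of i] 4 by auto
      qed (use 2 in simp)
    qed
  qed (use less.prems in auto)
qed


text \<open>Two of the three continuations agree for one more letter; which two changes cyclically with
  the level, hence the restriction to multiples of 3.\<close>

lemma branch_agreement:
  "\<exists>x. length x = Suc (length (branch (3 * j))) \<and>
    Sublist.prefix x (trib (Suc (3 * j)) @ branch (3 * j)) \<and>
    Sublist.prefix x (trib (Suc (3 * j)) @ trib (3 * j) @ branch (3 * j))"
proof (induction j)
  case 0
  show ?case by (rule exI[of _ "[Zero, One]"]) simp
next
  case (Suc j)
  have 1: "Sublist.prefix (trib (Suc (Suc k)) @ x) (trib (Suc (Suc k)) @ trib (Suc k) @ branch (Suc k))"
    if "Sublist.prefix x (trib (Suc k) @ branch k)" for k x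
    using that prefix_branch(2)[of k] by simp (metis prefix_order.trans same_prefix_prefix)
  have 2: "Sublist.prefix (trib (Suc (Suc k)) @ x) (trib (Suc (Suc (Suc k))) @ branch (Suc k))"
    if "Sublist.prefix x (trib (Suc k) @ trib k @ branch k)" for k x
    using that prefix_branch(2)[of k] by simp (metis prefix_order.trans same_prefix_prefix)
  have 3: "Sublist.prefix (trib (Suc (Suc k)) @ x) (trib (Suc (Suc k)) @ branch (Suc k))"
    if "Sublist.prefix x (trib (Suc (Suc k)) @ branch k)" for k x
    using that by simp
  define k where "k = 3 * j"
  obtain x where x: "length x = Suc (length (branch k))"
    "Sublist.prefix x (trib (Suc k) @ branch k)" "Sublist.prefix x (trib (Suc k) @ trib k @ branch k)"
    using Suc unfolding k_def by blast
  define y where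
    "y = trib (Suc (Suc (Suc (Suc k)))) @ trib (Suc (Suc (Suc k))) @ trib (Suc (Suc k)) @ x"
  have "length y = Suc (length (branch (Suc (Suc (Suc k)))))"
    by (simp add: y_def x(1))
  moreover have
    "Sublist.prefix y (trib (Suc (Suc (Suc (Suc k)))) @ branch (Suc (Suc (Suc k))))"
    unfolding y_def by (intro 1 2 3 x)
  moreover have "Sublist.prefix y
      (trib (Suc (Suc (Suc (Suc k)))) @ trib (Suc (Suc (Suc k))) @ branch (Suc (Suc (Suc k))))"
    unfolding y_def by (intro 1 2 3 x)
  moreover have "Suc (Suc (Suc k)) = 3 * Suc j" by (simp add: k_def)
  ultimately show ?case by metis
qed

lemma sublist_imp_take_drop:
  assumes "sublist u w"
  shows "\<exists>i. i + length u \<le> length w \<and> u = take (length u) (drop i w)"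
proof -
  obtain ps ss where w: "w = ps @ u @ ss" using assms by (auto simp: sublist_def)
  show ?thesis by (rule exI[of _ "length ps"]) (simp add: w)
qed

lemma card_factors_le:
  fixes j :: nat
  defines "N \<equiv> Suc (length (branch (3 * j)))"
  shows "card (factors_of_length N) \<le> 2 * N"
proof -
  define k a b c C where "k = 3 * j" and "a = trib k" and "b = trib (Suc k)"
    and "c = trib (Suc (Suc k))" and "C = branch k"
  have N: "N = Suc (length C)" by (simp add: N_def C_def k_def)
  define window where "window w i = take N (drop i w)" for w :: "letter list" and i
  \<comment> \<open>\<open>N\<close> exceeds \<open>length C\<close>, so an occurrence must start
    inside \<open>x\<close>.\<close>
  have sub: "\<exists>i<length x. u = window (x @ C) i"
    if u: "sublist u (x @ C)" "length u = N" for u x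
  proof -
    obtain i where "i + length u \<le> length (x @ C)" "u = take (length u) (drop i (x @ C))"
      using sublist_imp_take_drop[OF u(1)] by blast
    then show ?thesis unfolding window_def u(2)[symmetric] using u(2) by (intro exI[of _ i]) (simp add: N)
  qed
  \<comment> \<open>As \<open>k\<close> is a multiple of 3, \<open>a\<close>, \<open>b\<close>,
    \<open>c\<close> end in \<open>trib 0\<close>, \<open>trib 1\<close>,
    \<open>trib 2\<close>.\<close>
  obtain a' where a': "a = a' @ [One]"
    using suffix_trib_mod_3[of 0 j] by (auto simp: a_def k_def Sublist.suffix_def)
  obtain b' where b': "b = b' @ [Zero, One]"
    using suffix_trib_mod_3[of 1 j] by (auto simp: b_def k_def Sublist.suffix_def)
  obtain d where "c = d @ [Zero, Zero, One]"
    using suffix_trib_mod_3[of 2 j]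
    by (auto simp: c_def k_def Sublist.suffix_def numeral_2_eq_2)
  then obtain c' where c': "c = c' @ [Zero, One]" by (metis append.assoc append_Cons append_Nil)
  txt \<open>The window at position 0 is shared by \<open>b @ a @ C\<close> and \<open>b @ C\<close>, the window \<open>One # C\<close> by
    all three words, and the window \<open>[Zero, One] @ C\<close> by \<open>b @ C\<close> and \<open>c @ C\<close>; these four
    coincidences bring the count down to \<open>2 * N\<close>.\<close>
  obtain x where x: "length x = N" "Sublist.prefix x (b @ C)" "Sublist.prefix x (b @ a @ C)"
    using branch_agreement[of j] by (auto simp: N a_def b_def C_def k_def)
  define S where "S = window (b @ a @ C) ` {..<length b + length a} \<union>
    window (b @ C) ` {1..<length b - 1} \<union> window (c @ C) ` {..<length c - 2}"
  have "card S \<le> (length b + length a) + (length b - 2) + (length c - 2)"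
    unfolding S_def
    by (intro order.trans[OF card_Un_le] add_mono order.trans[OF card_image_le]) auto
  also have "\<dots> = 2 * N"
    using length_branch_eq[of k] b' c' by (simp add: N a_def b_def c_def C_def)
  finally have card: "card S \<le> 2 * N" .
  have S_ba: "u \<in> S" if "sublist u (b @ a @ C)" "length u = N" for u
    using sub[of u "b @ a"] that by (auto simp: S_def)
  have S_b: "u \<in> S" if u: "sublist u (b @ C)" "length u = N" for u
  proof -
    obtain i where i: "i < length b" "u = window (b @ C) i"
      using sub[OF u] by blast
    consider "i = 0" | "i \<in> {1..<length b - 1}" | "i = length b - 1"
      using i(1) by fastforce
    then show ?thesis
    proof cases
      case 1
      then have "u = take (length x) (b @ C)" using i x(1) by (simp add: window_def)
      then have "u = x" using x(2) by (metis append_eq_conv_conj prefixE)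
      then show ?thesis using x S_ba by (simp add: prefix_imp_sublist)
    next
      case 2
      then show ?thesis using i(2) by (auto simp: S_def)
    next
      case 3
      then have "u = One # C" using i(2) by (simp add: window_def b' N)
      then have "sublist u (b @ a @ C)"
        by (metis a' append.assoc append_Cons append_Nil sublist_append_leftI)
      then show ?thesis using S_ba u(2) by blast
    qed
  qed
  have S_c: "u \<in> S" if u: "sublist u (c @ C)" "length u = N" for u
  proof -
    obtain i where i: "i < length c" "u = window (c @ C) i"
      using sub[OF u] by blast
    show ?thesis
    proof (cases "i < length c - 2")
      case True
      then show ?thesis using i(2) by (auto simp: S_def)
    next
      case False
      then have "drop i (c @ C) = drop (i - (length c - 2)) ([Zero, One] @ C)"
        by (simp add: c')
      then have "sublist u ([Zero, One] @ C)"
        using i(2) unfolding window_def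
        by (metis sublist_drop sublist_order.order.trans sublist_take)
      then have "sublist u (b @ C)"
        by (metis b' append.assoc sublist_append_leftI sublist_order.order.trans)
      then show ?thesis using S_b u(2) by blast
    qed
  qed
  have "u \<in> S" if u: "u \<in> factors_of_length N" for u
  proof -
    obtain n where n: "2 \<le> n" "sublist u ([Zero, One] @ trib n)" and len: "length u = N"
      using u by (auto simp: factors_of_length_def factors_kimberling_word)
    \<comment> \<open>Large enough that \<open>trib n\<close> is a prefix of \<open>trib m\<close>
      and \<open>trib m @ C\<close> begins with \<open>C\<close>.\<close>
    define m where "m = max n (Suc k)"
    have "Sublist.prefix ([Zero, One] @ trib n) ([Zero, One] @ trib m @ C)"
      using prefix_trib[OF n(1), of m] by (simp add: m_def)
    then have "sublist u ([Zero, One] @ trib m @ C)"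
      using n(2) prefix_imp_sublist sublist_order.order.trans by blast
    moreover have "k < m" by (simp add: m_def)
    ultimately consider "sublist u ([Zero, One] @ C)" | "sublist u (trib m @ C)"
      using sublist_append_branch[OF _ _ prefix_branch_trib[of k m]] len N C_def by metis
    then show ?thesis
    proof cases
      case 1
      then have "sublist u (b @ C)"
        by (metis b' append.assoc sublist_append_leftI sublist_order.order.trans)
      then show ?thesis using S_b len by blast
    next
      case 2
      then show ?thesis
        using sublist_trib_branch[of u m k] \<open>k < m\<close> len S_ba S_b S_c
        by (auto simp: a_def b_def c_def C_def N)
    qed
  qed
  then have "card (factors_of_length N) \<le> card S"
    by (intro card_mono) (auto simp: S_def)
  with card show ?thesis by linarith
qed

theorem theorem5:
  fixes n :: nat
  assumes "n \<ge> 1"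
  shows "factor_complexity kimberling_word n = 2 * n"
proof -
  define N where "N = Suc (length (branch (3 * n)))"
  have "n \<le> N" using length_branch[of "3 * n"] by (simp add: N_def)
  then have "card (factors_of_length n) + 2 * (N - n) \<le> 2 * N"
    using card_factors_diff[OF assms] card_factors_le[of n] unfolding N_def
    by (meson order.trans)
  then have "card (factors_of_length n) = 2 * n"
    using card_factors_ge[OF assms] \<open>n \<le> N\<close> by linarith
  then show ?thesis by (simp add: factor_complexity_def factors_of_length_def)
qed

end
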